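(* If an algorithm for scheduling weighted jobs with online out-forest precedence constraints on $m$ parallel identical machines satisfies, at any time $t$ and for every $j\in F_t$, that \[R_j^t<1\ \Longrightarrow\ m\cdot\frac{w(S(j))}{W(t)}\le\rho\cdot R_j^t,\] where $R_j^t$ denotes the processing rate of $j$ at time $t$, then it is at most $(2+4\rho)$-competitive for minimizing the total weighted completion time.
   Context: Problem (non-clairvoyant scheduling with online precedence constraints on $m$ parallel identical machines): jobs $J$ with processing requirements $p_j\ge0$ and weights $w_j\ge0$; precedence DAG $G=(J,E)$ which is an out-forest (every job has at most one incoming edge). Time is discrete; at every time $t$ the algorithm assigns to each job a rate $R_j^t\in[0,1]$ with $\sum_jR_j^t\le m$ (such rates can be realized by an actual schedule on $m$ machines); $C_j$ is the first $t$ with $\sum_{t'\le t}R_j^{t'}\ge p_j$. Front jobs: $F_t=\{j: C_j>t,\ C_{j'}<t\ \forall(j',j)\in E\}$; only front jobs may receive positive rate. Jobs are revealed online when all predecessors are completed; processing requirements and $G$ are unknown. Objective: minimize $\sum_jw_jC_j$; $\rho'$-competitive means $\mathrm{Alg}\le\rho'\cdot\mathrm{Opt}$ always, where $\mathrm{Opt}$ is the offline optimum on the $m$ machines. $S(v)$ is $v$ with all its successors, $w(X)=\sum_{u\in X}w_u$, $U_t=\bigcup_{v\in F_t}S(v)$, $W(t)=w(U_t)$.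
   Formalization: Time slots start at 1; front jobs are those with C_j ≥ t instead of C_j > t (else no job with p_j > 0 could complete), and a job with p_j = 0 completes only after its predecessors have completed (else the bound fails); m ≥ 1 and ρ ≥ 0 are assumed. *)

theory Defs
  imports "HOL-Library.Extended_Nonnegative_Real" "HOL-Library.FuncSet"
begin

record 'a sched_instance =
  jobs :: "'a set"
  proc :: "'a \<Rightarrow> real"
  weight :: "'a \<Rightarrow> real"
  prec :: "('a \<times> 'a) set"

definition out_forest_instance :: "'a sched_instance \<Rightarrow> bool" where
  "out_forest_instance I \<longleftrightarrow>
     finite (jobs I) \<and>
     (\<forall>j\<in>jobs I. 0 \<le> proc I j \<and> 0 \<le> weight I j) \<and>
     prec I \<subseteq> jobs I \<times> jobs I \<and> acyclic (prec I) \<and>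
     (\<forall>i i' j. (i, j) \<in> prec I \<and> (i', j) \<in> prec I \<longrightarrow> i = i')"

text \<open>
  Time consists of the unit slots 1, 2, 3, ...; \<open>R t j\<close> is the rate of job \<open>j\<close> in slot \<open>t\<close>, and
  \<open>R 0\<close> is never used.  The set \<open>completed I R t\<close> consists of the jobs completed by the end of
  slot \<open>t\<close>.  The condition on the predecessors is needed only for jobs with processing
  requirement 0, which would otherwise complete in slot 1 even if their predecessors are
  unfinished; see \<open>completion_time_eq\<close> and \<open>completion_time_pos\<close> below.
\<close>

primrec completed :: "'a sched_instance \<Rightarrow> (nat \<Rightarrow> 'a \<Rightarrow> real) \<Rightarrow> nat \<Rightarrow> 'a set" where
  "completed I R 0 = {}"
| "completed I R (Suc t) = completed I R t \<union>
     {j \<in> jobs I. (\<forall>i. (i, j) \<in> prec I \<longrightarrow> i \<in> completed I R t) \<and>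
                  proc I j \<le> (\<Sum>s = 1..Suc t. R s j)}"

definition completion_time :: "'a sched_instance \<Rightarrow> (nat \<Rightarrow> 'a \<Rightarrow> real) \<Rightarrow> 'a \<Rightarrow> enat" where
  "completion_time I R j = Inf {enat t | t. j \<in> completed I R t}"

text \<open>
  A job that completes in slot \<open>t\<close> is still processed in slot \<open>t\<close>, hence the non-strict
  inequality for \<open>j\<close> itself.
\<close>

definition front :: "'a sched_instance \<Rightarrow> (nat \<Rightarrow> 'a \<Rightarrow> real) \<Rightarrow> nat \<Rightarrow> 'a set" where
  "front I R t = {j \<in> jobs I. enat t \<le> completion_time I R j \<and>
                     (\<forall>i. (i, j) \<in> prec I \<longrightarrow> completion_time I R i < enat t)}"

definition feasible :: "nat \<Rightarrow> 'a sched_instance \<Rightarrow> (nat \<Rightarrow> 'a \<Rightarrow> real) \<Rightarrow> bool" where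
  "feasible m I R \<longleftrightarrow>
     (\<forall>t\<ge>1. (\<forall>j\<in>jobs I. 0 \<le> R t j \<and> R t j \<le> 1) \<and>
            (\<Sum>j\<in>jobs I. R t j) \<le> real m \<and>
            (\<forall>j\<in>jobs I. 0 < R t j \<longrightarrow> j \<in> front I R t))"

definition total_cost :: "'a sched_instance \<Rightarrow> (nat \<Rightarrow> 'a \<Rightarrow> real) \<Rightarrow> ennreal" where
  "total_cost I R =
     (\<Sum>j\<in>jobs I. ennreal (weight I j) * ennreal_of_enat (completion_time I R j))"

definition opt :: "nat \<Rightarrow> 'a sched_instance \<Rightarrow> ennreal" where
  "opt m I = (INF R\<in>{R. feasible m I R}. total_cost I R)"

definition successors :: "'a sched_instance \<Rightarrow> 'a \<Rightarrow> 'a set" where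
  "successors I v = (prec I)\<^sup>* `` {v}"

definition total_weight :: "'a sched_instance \<Rightarrow> 'a set \<Rightarrow> real" where
  "total_weight I X = (\<Sum>u\<in>X. weight I u)"

definition front_weight :: "'a sched_instance \<Rightarrow> (nat \<Rightarrow> 'a \<Rightarrow> real) \<Rightarrow> nat \<Rightarrow> real" where
  "front_weight I R t = total_weight I (\<Union>v\<in>front I R t. successors I v)"

definition revealed :: "'a sched_instance \<Rightarrow> (nat \<Rightarrow> 'a \<Rightarrow> real) \<Rightarrow> nat \<Rightarrow> 'a set" where
  "revealed I R t = {j \<in> jobs I. \<forall>i. (i, j) \<in> prec I \<longrightarrow> completion_time I R i < enat t}"

text \<open>
  What is known at the beginning of slot \<open>t\<close>: the revealed jobs, their weights, the precedence
  edges between them, and which jobs were completed by the end of each earlier slot.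
\<close>

definition observed ::
  "'a sched_instance \<Rightarrow> (nat \<Rightarrow> 'a \<Rightarrow> real) \<Rightarrow> nat \<Rightarrow>
     'a set \<times> ('a \<Rightarrow> real) \<times> ('a \<times> 'a) set \<times> (nat \<Rightarrow> 'a set)" where
  "observed I R t =
     (revealed I R t, restrict (weight I) (revealed I R t),
      prec I \<inter> (revealed I R t \<times> revealed I R t), restrict (completed I R) {..<t})"

text \<open>
  An algorithm maps every instance to the rates it assigns.  Its rates in slot \<open>t\<close> may depend
  only on what has been observed so far and on side information \<open>pred I\<close> (a prediction, for
  example of the weights of the sets of successors).  A constant \<open>pred\<close> gives algorithms
  without side information.
\<close>

definition online_algorithm ::
  "nat \<Rightarrow> ('a sched_instance \<Rightarrow> 'p) \<Rightarrow> ('a sched_instance \<Rightarrow> nat \<Rightarrow> 'a \<Rightarrow> real) \<Rightarrow> bool" where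
  "online_algorithm m pred A \<longleftrightarrow>
     (\<forall>I. out_forest_instance I \<longrightarrow> feasible m I (A I)) \<and>
     (\<forall>I I' t. out_forest_instance I \<and> out_forest_instance I' \<and> 1 \<le> t \<and> pred I = pred I' \<and>
        observed I (A I) t = observed I' (A I') t \<longrightarrow>
        (\<forall>j\<in>revealed I (A I) t. A I t j = A I' t j))"

definition competitive ::
  "nat \<Rightarrow> ('a sched_instance \<Rightarrow> nat \<Rightarrow> 'a \<Rightarrow> real) \<Rightarrow> real \<Rightarrow> bool" where
  "competitive m A c \<longleftrightarrow>
     (\<forall>I. out_forest_instance I \<longrightarrow> total_cost I (A I) \<le> ennreal c * opt m I)"

lemma completed_mono: "s \<le> t \<Longrightarrow> completed I R s \<subseteq> completed I R t"
  by (rule lift_Suc_mono_le) auto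

lemma completion_time_le_iff: "completion_time I R j \<le> enat t \<longleftrightarrow> j \<in> completed I R t"
proof
  assume le: "completion_time I R j \<le> enat t"
  let ?S = "{enat t | t. j \<in> completed I R t}"
  have "?S \<noteq> {}"
    using le by (auto simp: completion_time_def Inf_enat_def split: if_splits)
  then have "Inf ?S \<in> ?S"
    unfolding Inf_enat_def by (simp only: if_False) (rule LeastI_ex, blast)
  then obtain s where "completion_time I R j = enat s" "j \<in> completed I R s"
    by (auto simp: completion_time_def)
  with le show "j \<in> completed I R t"
    using completed_mono[of s t I R] by auto
next
  assume "j \<in> completed I R t"
  then show "completion_time I R j \<le> enat t"
    by (auto simp: completion_time_def intro: Inf_lower)
qed

lemma completion_time_less_iff:
  "completion_time I R j < enat (Suc t) \<longleftrightarrow> j \<in> completed I R t"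
proof -
  have "x < enat (Suc t) \<longleftrightarrow> x \<le> enat t" for x
    by (cases x) auto
  then show ?thesis by (simp add: completion_time_le_iff)
qed

lemma completedD:
  "j \<in> completed I R t \<Longrightarrow>
     \<exists>s. 1 \<le> s \<and> s \<le> t \<and> (\<forall>i. (i, j) \<in> prec I \<longrightarrow> completion_time I R i < enat s) \<and>
         proc I j \<le> (\<Sum>u = 1..s. R u j)"
proof (induction t)
  case (Suc t)
  show ?case
  proof (cases "j \<in> completed I R t")
    case True
    with Suc.IH show ?thesis by (meson le_SucI)
  next
    case False
    with Suc.prems show ?thesis
      by (intro exI[of _ "Suc t"]) (auto simp: completion_time_less_iff)
  qed
qed simp

lemma completedI:
  assumes "j \<in> jobs I" "1 \<le> t" "\<forall>i. (i, j) \<in> prec I \<longrightarrow> completion_time I R i < enat t"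
    "proc I j \<le> (\<Sum>u = 1..t. R u j)"
  shows "j \<in> completed I R t"
  using assms by (cases t) (auto simp: completion_time_less_iff)

lemma completion_time_eq:
  assumes "j \<in> jobs I"
  shows "completion_time I R j =
    Inf {enat t | t. 1 \<le> t \<and> (\<forall>i. (i, j) \<in> prec I \<longrightarrow> completion_time I R i < enat t) \<and>
                     proc I j \<le> (\<Sum>s = 1..t. R s j)}"
    (is "_ = Inf ?S")
proof (rule antisym)
  show "completion_time I R j \<le> Inf ?S"
    by (rule Inf_greatest) (auto simp: completion_time_le_iff intro!: completedI assms)
  show "Inf ?S \<le> completion_time I R j"
    unfolding completion_time_def[of I R j]
  proof (rule Inf_greatest)
    fix x assume "x \<in> {enat t | t. j \<in> completed I R t}"
    then obtain t where t: "x = enat t" "j \<in> completed I R t" by blast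
    from completedD[OF t(2)] obtain s where s: "s \<le> t" "enat s \<in> ?S" by blast
    then have "Inf ?S \<le> enat s" by (intro Inf_lower)
    with s(1) t(1) show "Inf ?S \<le> x" by (simp add: order_trans)
  qed
qed

lemma completion_time_pos:
  assumes "feasible m I R" "j \<in> jobs I" "0 < proc I j"
  shows "completion_time I R j = Inf {enat t | t. 1 \<le> t \<and> proc I j \<le> (\<Sum>s = 1..t. R s j)}"
    (is "_ = Inf ?S")
proof (rule antisym)
  show "Inf ?S \<le> completion_time I R j"
    unfolding completion_time_eq[OF assms(2)] by (rule Inf_superset_mono) blast
  show "completion_time I R j \<le> Inf ?S"
  proof (rule Inf_greatest)
    fix x assume "x \<in> ?S"
    then obtain t where t: "x = enat t" "proc I j \<le> (\<Sum>s = 1..t. R s j)" by blast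
    define u where "u = (LEAST u. proc I j \<le> (\<Sum>s = 1..u. R s j))"
    have u: "proc I j \<le> (\<Sum>s = 1..u. R s j)" "u \<le> t"
      unfolding u_def using t(2) by (rule LeastI, rule Least_le)
    have "u \<noteq> 0" using u(1) assms(3) by (cases u) auto
    then obtain v where v: "u = Suc v" by (cases u) auto
    have "\<not> proc I j \<le> (\<Sum>s = 1..v. R s j)"
      using not_less_Least[of v "\<lambda>u. proc I j \<le> (\<Sum>s = 1..u. R s j)"] v
      unfolding u_def by simp
    with u(1) have "0 < R u j" by (simp add: v)
    with assms(1,2) v have "j \<in> front I R u" by (auto simp: feasible_def)
    then have "j \<in> completed I R u"
      using assms(2) u(1) v by (intro completedI) (auto simp: front_def)
    then have "completion_time I R j \<le> enat u" by (simp add: completion_time_le_iff)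
    with u(2) t(1) show "completion_time I R j \<le> x" by (simp add: order_trans)
  qed
qed

end

theory Submission
  imports Defs
begin

text \<open>
  Write \<open>R\<close> for the schedule of the algorithm, \<open>W(t)\<close> for the weight unfinished in slot \<open>t\<close>, and
  \<open>Q\<close> for a competing schedule with completion times \<open>C*\<close> and cost \<open>K\<close>.  The cost of \<open>R\<close> is
  \<open>\<Sum>t. W(t)\<close>, and \<open>W(t)\<close> is at most the sum of the weights of the successor sets of three kinds of
  front jobs \<open>i\<close>.

  If \<open>i\<close> runs at rate 1 or completes in slot \<open>t\<close>, the slot is charged to one in which \<open>Q\<close> has \<open>i\<close>
  at the front; on the path leading to a job \<open>v\<close> these are disjoint, so \<open>v\<close> is charged at most
  \<open>C*(v)\<close> times.  If \<open>t < 2\<rho> C*(i)\<close>, then \<open>t < 2\<rho> C*(v)\<close> for all successors \<open>v\<close> of \<open>i\<close>, so \<open>v\<close> is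
  charged at most \<open>2\<rho> C*(v)\<close> times.  In the remaining case \<open>w(S(i)) \<le> \<rho> R(t, i) W(t) / m\<close>, and up to
  slot \<open>t\<close> the work done on such jobs is at most \<open>m t / (2\<rho>)\<close>, since \<open>Q\<close> has finished them by time
  \<open>t / (2\<rho>)\<close>; as \<open>W\<close> is decreasing, summation by parts bounds these charges by half the cost of
  \<open>R\<close>.  Hence that cost is at most \<open>2 (1 + 2\<rho>) K\<close>.  The last step subtracts half the cost, so the
  sums are truncated at a slot \<open>T\<close>: the cost could a priori be infinite.
\<close>

section \<open>Sums and extended reals\<close>

lemma sum_mult_antimono_le:
  fixes W h :: "nat \<Rightarrow> real"
  assumes antimono: "\<And>t. 1 \<le> t \<Longrightarrow> W (Suc t) \<le> W t"
    and nonneg: "\<And>t. 0 \<le> W t"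
    and partial_sums: "\<And>t. (\<Sum>u = 1..t. h u) \<le> b * real t"
  shows "(\<Sum>t = 1..T. W t * h t) \<le> b * (\<Sum>t = 1..T. W t)"
proof -
  let ?slack = "\<lambda>t. b * real t - (\<Sum>u = 1..t. h u)"
  have "W T * ?slack T \<le> b * (\<Sum>t = 1..T. W t) - (\<Sum>t = 1..T. W t * h t)"
  proof (induction T)
    case (Suc T)
    have "W (Suc T) * ?slack T \<le> W T * ?slack T"
      using antimono[of T] partial_sums[of T] by (cases "T = 0") (auto intro: mult_right_mono)
    with Suc show ?case by (simp add: algebra_simps)
  qed simp
  moreover have "0 \<le> W T * ?slack T" using nonneg partial_sums by simp
  ultimately show ?thesis by linarith
qed

lemma card_nat_less_real_le:
  fixes x :: real
  assumes "0 \<le> x"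
  shows "real (card {t \<in> {1..T}. real t < x}) \<le> x"
proof -
  have "{t \<in> {1..T}. real t < x} \<subseteq> {1..nat \<lfloor>x\<rfloor>}"
    using le_nat_floor[OF less_imp_le] by auto
  then have "card {t \<in> {1..T}. real t < x} \<le> nat \<lfloor>x\<rfloor>"
    using card_mono[OF finite_atLeastAtMost] by (metis card_atLeastAtMost diff_Suc_1)
  then show ?thesis using assms by linarith
qed

lemma ennreal_of_enat_eq_suminf:
  "ennreal_of_enat x = (\<Sum>t. if enat t < x then 1 else 0)"
proof (cases x)
  case (enat n)
  have "(\<Sum>t. if t < n then 1 else 0 :: ennreal) = (\<Sum>t<n. if t < n then 1 else 0)"
    by (rule suminf_finite) auto
  with enat show ?thesis by simp
next
  case infinity
  have "(\<Sum>t. 1 :: ennreal) = (SUP n. of_nat n)" by (simp add: suminf_eq_SUP)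
  with infinity show ?thesis by (simp add: ennreal_SUP_of_nat_eq_top)
qed

lemma ennreal_le_mult_INF:
  fixes c :: ennreal
  assumes "0 < c" "c < top" "\<And>i. i \<in> A \<Longrightarrow> x \<le> c * f i"
  shows "x \<le> c * (INF i\<in>A. f i)"
proof -
  have "x / c \<le> (INF i\<in>A. f i)"
    using assms by (intro INF_greatest divide_le_posI_ennreal) (auto simp: mult.commute)
  then have "c * (x / c) \<le> c * (INF i\<in>A. f i)" by (rule mult_left_mono) simp
  then show ?thesis
    using assms(1,2)
    by (simp add: ennreal_times_divide mult_divide_eq_ennreal mult.commute[of c] less_top)
qed

section \<open>Completion times and rates\<close>

lemma prec_completion_time_less:
  assumes "(i, v) \<in> prec I" "completion_time I R v = enat c"
  shows "completion_time I R i < enat c"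
proof -
  have "v \<in> completed I R c"
    using assms(2) completion_time_le_iff[of I R v c] by simp
  from completedD[OF this] obtain s where "s \<le> c" "completion_time I R i < enat s"
    using assms(1) by blast
  then show ?thesis by (meson enat_ord_simps(1) less_le_trans)
qed

lemma completion_time_successors_le:
  assumes "v \<in> successors I i"
  shows "completion_time I R i \<le> completion_time I R v"
proof -
  have "(i, v) \<in> (prec I)\<^sup>*" using assms by (simp add: successors_def)
  then show ?thesis
  proof (induction rule: rtrancl_induct)
    case (step y z)
    show ?case
    proof (cases "completion_time I R z")
      case (enat c)
      with prec_completion_time_less[OF step.hyps(2) enat] step.IH show ?thesis by simp
    qed simp
  qed simp
qed

lemma completed_successorsD:
  assumes "v \<in> completed I R t" "v \<in> successors I i"
  shows "i \<in> completed I R t"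
  using assms(1) completion_time_successors_le[OF assms(2), of R]
  by (metis completion_time_le_iff order_trans)

lemma completed_imp_job: "j \<in> completed I R t \<Longrightarrow> j \<in> jobs I"
  by (induction t) auto

lemma front_subset_jobs: "front I R t \<subseteq> jobs I"
  by (auto simp: front_def)

lemma front_at_completion_time:
  "j \<in> jobs I \<Longrightarrow> completion_time I R j = enat t \<Longrightarrow> j \<in> front I R t"
  by (auto simp: front_def prec_completion_time_less)

lemma proc_le_sum_rates:
  assumes "feasible m I R" "i \<in> completed I R c"
  shows "proc I i \<le> (\<Sum>u = 1..c. R u i)"
proof -
  from completedD[OF assms(2)] obtain s
    where s: "s \<le> c" "proc I i \<le> (\<Sum>u = 1..s. R u i)" by blast
  have "i \<in> jobs I" using assms(2) by (rule completed_imp_job)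
  then have "(\<Sum>u = 1..s. R u i) \<le> (\<Sum>u = 1..c. R u i)"
    using assms(1) s(1) by (intro sum_mono2) (auto simp: feasible_def)
  with s(2) show ?thesis by simp
qed

lemma sum_proc_completed_le:
  assumes "feasible m I R" "finite (jobs I)" "X \<subseteq> completed I R c"
  shows "(\<Sum>i\<in>X. proc I i) \<le> real m * real c"
proof -
  have "X \<subseteq> jobs I" using assms(3) by (auto dest: completed_imp_job)
  have "(\<Sum>i\<in>X. proc I i) \<le> (\<Sum>i\<in>X. \<Sum>u = 1..c. R u i)"
    using assms by (intro sum_mono proc_le_sum_rates) auto
  also have "\<dots> \<le> (\<Sum>i\<in>jobs I. \<Sum>u = 1..c. R u i)"
    using assms \<open>X \<subseteq> jobs I\<close>
    by (intro sum_mono2) (auto simp: feasible_def intro!: sum_nonneg)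
  also have "\<dots> = (\<Sum>u = 1..c. \<Sum>i\<in>jobs I. R u i)" by (rule sum.swap)
  also have "\<dots> \<le> (\<Sum>u = 1..c. real m)"
    using assms(1) by (intro sum_mono) (auto simp: feasible_def)
  finally show ?thesis by (simp add: mult.commute)
qed

lemma sum_rates_less_proc:
  assumes "feasible m I R" "finite K" "K \<noteq> {}"
    and before_completion:
      "\<And>t. t \<in> K \<Longrightarrow> 1 \<le> t \<and> i \<in> front I R t \<and> enat t < completion_time I R i"
  shows "(\<Sum>t\<in>K. R t i) < proc I i"
proof -
  have last: "1 \<le> Max K" "i \<in> front I R (Max K)" "enat (Max K) < completion_time I R i"
    using before_completion[of "Max K"] assms(2,3) by auto
  have "(\<Sum>t\<in>K. R t i) \<le> (\<Sum>u = 1..Max K. R u i)"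
    using assms last(2) by (intro sum_mono2) (auto simp: feasible_def front_def)
  also have "\<dots> < proc I i"
  proof (rule ccontr)
    assume "\<not> ?thesis"
    with last(1,2) have "i \<in> completed I R (Max K)"
      by (intro completedI) (auto simp: front_def)
    with last(3) show False by (simp flip: completion_time_le_iff)
  qed
  finally show ?thesis .
qed

section \<open>Saturated slots\<close>

definition front_slots :: "'a sched_instance \<Rightarrow> (nat \<Rightarrow> 'a \<Rightarrow> real) \<Rightarrow> nat \<Rightarrow> 'a \<Rightarrow> nat set" where
  "front_slots I R c i = {s \<in> {1..c}. i \<in> front I R s}"

definition saturated :: "'a sched_instance \<Rightarrow> (nat \<Rightarrow> 'a \<Rightarrow> real) \<Rightarrow> nat \<Rightarrow> 'a set" where
  "saturated I R t = {i \<in> front I R t. R t i = 1 \<or> completion_time I R i = enat t}"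

lemma finite_front_slots: "finite (front_slots I R c i)"
  by (simp add: front_slots_def)

lemma front_diff_saturatedD:
  assumes "feasible m I R" "1 \<le> t" "i \<in> front I R t - saturated I R t"
  shows "R t i < 1" "enat t < completion_time I R i"
  using assms by (auto simp: feasible_def saturated_def front_def order.order_iff_strict)

lemma card_front_slots_pos:
  assumes "i \<in> completed I R c"
  shows "0 < card (front_slots I R c i)"
proof -
  obtain d where d: "completion_time I R i = enat d" "d \<le> c"
    using assms by (cases "completion_time I R i") (auto simp flip: completion_time_le_iff)
  have "i \<in> completed I R d" by (simp flip: completion_time_le_iff add: d(1))
  then have "d \<noteq> 0" by (cases d) auto
  moreover have "i \<in> front I R d"
    using completed_imp_job[OF assms] d(1) by (rule front_at_completion_time)
  ultimately have "d \<in> front_slots I R c i"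
    using d(2) by (simp add: front_slots_def)
  then show ?thesis using finite_front_slots by (auto simp: card_gt_0_iff)
qed

lemma proc_le_card_front_slots:
  assumes "feasible m I R" "i \<in> completed I R c"
  shows "proc I i \<le> real (card (front_slots I R c i))"
proof -
  have i: "i \<in> jobs I" using assms(2) by (rule completed_imp_job)
  have "proc I i \<le> (\<Sum>u = 1..c. R u i)" using assms by (rule proc_le_sum_rates)
  also have "\<dots> = (\<Sum>u\<in>front_slots I R c i. R u i)"
  proof (rule sum.mono_neutral_right)
    show "\<forall>u\<in>{1..c} - front_slots I R c i. R u i = 0"
      using assms(1) i by (fastforce simp: feasible_def front_slots_def)
  qed (auto simp: front_slots_def)
  also have "\<dots> \<le> (\<Sum>u\<in>front_slots I R c i. 1)"
    using assms(1) i by (intro sum_mono) (auto simp: feasible_def front_slots_def)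
  finally show ?thesis by simp
qed

text \<open>
  Apart from the last one, the saturated slots of \<open>i\<close> number strictly less than \<open>proc I i\<close>.
  Integrality therefore leaves room for the last slot, even if \<open>R\<close> overshoots the processing
  requirement in it.
\<close>

lemma card_saturated_slots_le_front_slots:
  assumes "feasible m I R" "feasible m' I Q" "i \<in> completed I Q c"
  shows "card {t \<in> {1..T}. i \<in> saturated I R t} \<le> card (front_slots I Q c i)"
    (is "card ?S \<le> _")
proof (cases "?S - {Max ?S} = {}")
  case True
  then have "card ?S \<le> card {Max ?S}" by (intro card_mono) auto
  with card_front_slots_pos[OF assms(3)] show ?thesis by simp
next
  case False
  then have last: "Max ?S \<in> ?S" by (intro Max_in) auto
  have rate_1_before_completion:
    "1 \<le> t \<and> i \<in> front I R t \<and> enat t < completion_time I R i \<and> R t i = 1"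
    if "t \<in> ?S - {Max ?S}" for t
  proof -
    have "t < Max ?S" using that Max_ge[of ?S t] by (auto simp: order.order_iff_strict)
    moreover have "enat (Max ?S) \<le> completion_time I R i"
      using last by (auto simp: saturated_def front_def)
    ultimately have "enat t < completion_time I R i" by (meson enat_ord_simps(2) less_le_trans)
    then show ?thesis using that by (auto simp: saturated_def)
  qed
  have "real (card (?S - {Max ?S})) = (\<Sum>t\<in>?S - {Max ?S}. R t i)"
    using rate_1_before_completion by simp
  also have "\<dots> < proc I i"
    using assms(1) False rate_1_before_completion by (intro sum_rates_less_proc) auto
  also have "\<dots> \<le> real (card (front_slots I Q c i))"
    using assms(2,3) by (rule proc_le_card_front_slots)
  finally show ?thesis using card_Suc_Diff1[OF _ last] by simp
qed

section \<open>Weights of successor sets\<close>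

locale dag_instance =
  fixes I :: "'a sched_instance"
  assumes finite_jobs: "finite (jobs I)"
    and proc_nonneg: "j \<in> jobs I \<Longrightarrow> 0 \<le> proc I j"
    and weight_nonneg: "j \<in> jobs I \<Longrightarrow> 0 \<le> weight I j"
    and prec_subset_jobs: "prec I \<subseteq> jobs I \<times> jobs I"
    and acyclic_prec: "acyclic (prec I)"
begin

lemma successors_subset_jobs:
  assumes "v \<in> jobs I"
  shows "successors I v \<subseteq> jobs I"
proof
  fix u assume "u \<in> successors I v"
  then have "(v, u) \<in> (prec I)\<^sup>*" by (simp add: successors_def)
  then show "u \<in> jobs I"
    by (cases rule: rtranclE) (use assms prec_subset_jobs in auto)
qed

lemma UN_successors_subset_jobs: "X \<subseteq> jobs I \<Longrightarrow> (\<Union>i\<in>X. successors I i) \<subseteq> jobs I"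
  using successors_subset_jobs by blast

lemma exists_front_ancestor:
  assumes "v \<in> jobs I" "enat t \<le> completion_time I R v"
  shows "\<exists>i\<in>front I R t. v \<in> successors I i"
proof -
  have "wf (prec I)"
    using finite_jobs prec_subset_jobs acyclic_prec
    by (intro finite_acyclic_wf) (auto intro: finite_subset)
  then show ?thesis using assms
  proof (induction v rule: wf_induct_rule)
    case (less v)
    show ?case
    proof (cases "v \<in> front I R t")
      case True
      then show ?thesis by (auto simp: successors_def)
    next
      case False
      with less.prems obtain i where i: "(i, v) \<in> prec I" "enat t \<le> completion_time I R i"
        by (auto simp: front_def not_less)
      then obtain k where "k \<in> front I R t" "i \<in> successors I k"
        using less.IH prec_subset_jobs by blast
      with i(1) show ?thesis
        by (auto simp: successors_def intro: rtrancl_into_rtrancl)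
    qed
  qed
qed

lemma UN_successors_front:
  "(\<Union>i\<in>front I R t. successors I i) = {v \<in> jobs I. enat t \<le> completion_time I R v}"
proof (intro equalityI subsetI)
  fix v assume "v \<in> (\<Union>i\<in>front I R t. successors I i)"
  then obtain i where i: "i \<in> front I R t" "v \<in> successors I i" by blast
  then have "enat t \<le> completion_time I R v"
    using completion_time_successors_le[OF i(2), of R] by (auto simp: front_def)
  then show "v \<in> {v \<in> jobs I. enat t \<le> completion_time I R v}"
    using i UN_successors_subset_jobs[OF front_subset_jobs, of R t] by blast
qed (use exists_front_ancestor in blast)

lemma total_weight_nonneg: "X \<subseteq> jobs I \<Longrightarrow> 0 \<le> total_weight I X"
  unfolding total_weight_def using weight_nonneg by (intro sum_nonneg) auto

lemma total_weight_mono: "X \<subseteq> Y \<Longrightarrow> Y \<subseteq> jobs I \<Longrightarrow> total_weight I X \<le> total_weight I Y"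
  unfolding total_weight_def
  using finite_jobs weight_nonneg by (intro sum_mono2) (auto intro: finite_subset)

lemma total_weight_Un_le:
  assumes "X \<subseteq> jobs I" "Y \<subseteq> jobs I"
  shows "total_weight I (X \<union> Y) \<le> total_weight I X + total_weight I Y"
proof -
  have "finite X" "finite Y" using assms finite_jobs finite_subset by blast+
  then have "total_weight I (X \<union> Y) + total_weight I (X \<inter> Y) = total_weight I X + total_weight I Y"
    unfolding total_weight_def by (rule sum.union_inter)
  moreover have "0 \<le> total_weight I (X \<inter> Y)"
    using assms by (intro total_weight_nonneg) auto
  ultimately show ?thesis by linarith
qed

lemma total_weight_UN_le:
  assumes "finite X" "\<And>i. i \<in> X \<Longrightarrow> S i \<subseteq> jobs I"
  shows "total_weight I (\<Union>i\<in>X. S i) \<le> (\<Sum>i\<in>X. total_weight I (S i))"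
  using assms
proof (induction X rule: finite_induct)
  case (insert x X)
  then have "total_weight I (S x \<union> (\<Union>i\<in>X. S i))
      \<le> total_weight I (S x) + total_weight I (\<Union>i\<in>X. S i)"
    by (intro total_weight_Un_le) auto
  with insert show ?case by fastforce
qed (simp add: total_weight_def)

lemma front_weight_le_diff:
  assumes "X \<subseteq> front I R t"
  shows "front_weight I R t \<le> total_weight I (\<Union>i\<in>front I R t - X. successors I i) +
    total_weight I (\<Union>i\<in>X. successors I i)"
proof -
  have "(\<Union>i\<in>front I R t. successors I i) =
      (\<Union>i\<in>front I R t - X. successors I i) \<union> (\<Union>i\<in>X. successors I i)"
    using assms by auto
  then show ?thesis
    unfolding front_weight_def using assms
    by (simp only:) (intro total_weight_Un_le UN_successors_subset_jobs, auto simp: front_def)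
qed

lemma front_weight_nonneg: "0 \<le> front_weight I R t"
  unfolding front_weight_def by (rule total_weight_nonneg) (auto simp: UN_successors_front)

lemma front_weight_Suc_le: "front_weight I R (Suc t) \<le> front_weight I R t"
  unfolding front_weight_def UN_successors_front
  by (intro total_weight_mono) (auto simp: Suc_ile_eq)

section \<open>Cost as accumulated weight\<close>

lemma total_cost_eq_suminf_front_weight:
  "total_cost I R = (\<Sum>t. ennreal (front_weight I R (Suc t)))"
proof -
  have slot: "ennreal (front_weight I R (Suc t)) =
      (\<Sum>v\<in>jobs I. ennreal (weight I v) * (if enat t < completion_time I R v then 1 else 0))" for t
  proof -
    have "front_weight I R (Suc t) =
        (\<Sum>v\<in>jobs I. if enat t < completion_time I R v then weight I v else 0)"
      unfolding front_weight_def UN_successors_front total_weight_def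
      using finite_jobs by (simp add: sum.inter_filter Suc_ile_eq)
    then show ?thesis
      using weight_nonneg by (simp flip: sum_ennreal add: if_distrib cong: if_cong)
  qed
  have "total_cost I R = (\<Sum>v\<in>jobs I.
      \<Sum>t. ennreal (weight I v) * (if enat t < completion_time I R v then 1 else 0))"
    by (simp add: total_cost_def ennreal_of_enat_eq_suminf)
  also have "\<dots> = (\<Sum>t. ennreal (front_weight I R (Suc t)))"
    unfolding slot by (rule suminf_sum[symmetric]) simp
  finally show ?thesis .
qed

lemma total_cost_leI:
  assumes "\<And>T. ennreal (\<Sum>t = 1..T. front_weight I R t) \<le> K"
  shows "total_cost I R \<le> K"
  unfolding total_cost_eq_suminf_front_weight
proof (rule suminf_le_const)
  fix T
  have "(\<Sum>t<T. ennreal (front_weight I R (Suc t))) = ennreal (\<Sum>t = 1..T. front_weight I R t)"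
    by (simp add: sum_ennreal front_weight_nonneg sum.atLeast1_atMost_eq)
  with assms show "(\<Sum>t<T. ennreal (front_weight I R (Suc t))) \<le> K" by simp
qed simp

lemma sum_total_weight_eq:
  assumes "finite K" "\<And>t. t \<in> K \<Longrightarrow> Y t \<subseteq> jobs I"
  shows "(\<Sum>t\<in>K. total_weight I (Y t)) = (\<Sum>v\<in>jobs I. weight I v * real (card {t \<in> K. v \<in> Y t}))"
proof -
  have "(\<Sum>t\<in>K. total_weight I (Y t)) = (\<Sum>t\<in>K. \<Sum>v\<in>{v \<in> jobs I. v \<in> Y t}. weight I v)"
    unfolding total_weight_def using assms(2) by (intro sum.cong) auto
  also have "\<dots> = (\<Sum>v\<in>jobs I. \<Sum>t\<in>{t \<in> K. v \<in> Y t}. weight I v)"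
    using assms(1) finite_jobs by (rule sum.swap_restrict)
  finally show ?thesis by (simp add: mult.commute)
qed

text \<open>Positivity of \<open>\<alpha>\<close> matters, as \<open>0 * \<infinity> = 0\<close> in the extended reals.\<close>

lemma sum_total_weight_le_total_cost:
  assumes "finite K" "\<And>t. t \<in> K \<Longrightarrow> Y t \<subseteq> jobs I" "0 < \<alpha>"
    and card_le: "\<And>v c. v \<in> completed I Q c \<Longrightarrow> real (card {t \<in> K. v \<in> Y t}) \<le> \<alpha> * real c"
  shows "ennreal (\<Sum>t\<in>K. total_weight I (Y t)) \<le> ennreal \<alpha> * total_cost I Q"
proof -
  let ?n = "\<lambda>v. real (card {t \<in> K. v \<in> Y t})"
  have card_le_completion_time:
    "ennreal (?n v) \<le> ennreal \<alpha> * ennreal_of_enat (completion_time I Q v)" for v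
  proof (cases "completion_time I Q v")
    case (enat c)
    then have "v \<in> completed I Q c" by (simp flip: completion_time_le_iff)
    then have "ennreal (?n v) \<le> ennreal (\<alpha> * real c)" by (intro ennreal_leI card_le)
    with enat \<open>0 < \<alpha>\<close> show ?thesis by (simp add: ennreal_mult' ennreal_of_nat_eq_real_of_nat)
  qed (use \<open>0 < \<alpha>\<close> in \<open>simp add: ennreal_mult_top\<close>)
  have "ennreal (\<Sum>t\<in>K. total_weight I (Y t)) = (\<Sum>v\<in>jobs I. ennreal (weight I v) * ennreal (?n v))"
    using weight_nonneg
    by (simp add: sum_total_weight_eq[OF assms(1,2)] ennreal_mult' flip: sum_ennreal)
  also have "\<dots> \<le> (\<Sum>v\<in>jobs I. ennreal (weight I v) *
      (ennreal \<alpha> * ennreal_of_enat (completion_time I Q v)))"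
    by (intro sum_mono mult_left_mono card_le_completion_time) simp
  also have "\<dots> = ennreal \<alpha> * total_cost I Q"
    by (simp add: total_cost_def sum_distrib_left mult.left_commute)
  finally show ?thesis .
qed

end

section \<open>Charging saturated slots\<close>

locale out_forest = dag_instance +
  assumes prec_unique: "(i, j) \<in> prec I \<Longrightarrow> (i', j) \<in> prec I \<Longrightarrow> i = i'"
begin

lemma front_ancestor_unique:
  assumes "i \<in> front I R t" "k \<in> front I R t" "v \<in> successors I i" "v \<in> successors I k"
  shows "i = k"
proof -
  have no_front_successor: "a = b"
    if a: "a \<in> front I R t" and b: "b \<in> front I R t" and path: "(a, b) \<in> (prec I)\<^sup>*" for a b
    using path
  proof (cases rule: rtranclE)
    case (step y)
    have "completion_time I R a \<le> completion_time I R y"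
      using step(1) by (intro completion_time_successors_le) (simp add: successors_def)
    also have "\<dots> < enat t" using step(2) b by (auto simp: front_def)
    finally show ?thesis using a by (auto simp: front_def)
  qed simp
  have "single_valued ((prec I)\<inverse>)"
    using prec_unique by (auto simp: single_valued_def)
  moreover have "(v, i) \<in> ((prec I)\<inverse>)\<^sup>*" "(v, k) \<in> ((prec I)\<inverse>)\<^sup>*"
    using assms(3,4) by (auto simp: successors_def rtrancl_converse)
  ultimately have "(i, k) \<in> ((prec I)\<inverse>)\<^sup>* \<or> (k, i) \<in> ((prec I)\<inverse>)\<^sup>*"
    by (rule single_valued_confluent)
  then show ?thesis using no_front_successor assms(1,2) by (auto simp: rtrancl_converse)
qed

lemma sum_card_front_slots_ancestors_le:
  "(\<Sum>i | i \<in> jobs I \<and> v \<in> successors I i. card (front_slots I R c i)) \<le> c"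
proof -
  let ?A = "{i \<in> jobs I. v \<in> successors I i}"
  have "(\<Sum>i\<in>?A. card (front_slots I R c i)) = card (\<Union>i\<in>?A. front_slots I R c i)"
  proof (rule card_UN_disjoint[symmetric])
    show "\<forall>i\<in>?A. \<forall>k\<in>?A. i \<noteq> k \<longrightarrow> front_slots I R c i \<inter> front_slots I R c k = {}"
      using front_ancestor_unique by (fastforce simp: front_slots_def)
  qed (use finite_jobs finite_front_slots in auto)
  also have "\<dots> \<le> card {1..c}" by (intro card_mono) (auto simp: front_slots_def)
  finally show ?thesis by simp
qed

lemma card_slots_saturated_ancestor_le:
  assumes "feasible m I R" "feasible m' I Q" "v \<in> completed I Q c"
  shows "card {t \<in> {1..T}. v \<in> (\<Union>i\<in>saturated I R t. successors I i)} \<le> c"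
proof -
  let ?A = "{i \<in> jobs I. v \<in> successors I i}"
  have "{t \<in> {1..T}. v \<in> (\<Union>i\<in>saturated I R t. successors I i)} =
      (\<Union>i\<in>?A. {t \<in> {1..T}. i \<in> saturated I R t})"
    by (auto simp: saturated_def front_def)
  also have "card \<dots> \<le> (\<Sum>i\<in>?A. card {t \<in> {1..T}. i \<in> saturated I R t})"
    using finite_jobs by (intro card_UN_le) simp
  also have "\<dots> \<le> (\<Sum>i\<in>?A. card (front_slots I Q c i))"
    using assms
    by (intro sum_mono card_saturated_slots_le_front_slots) (auto dest: completed_successorsD)
  also have "\<dots> \<le> c" by (rule sum_card_front_slots_ancestors_le)
  finally show ?thesis .
qed

end

section \<open>Lagging jobs\<close>

text \<open>
  Written without division: for \<open>\<alpha> = 0\<close> these are all jobs that \<open>Q\<close> ever completes.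
\<close>

definition early_completed ::
  "'a sched_instance \<Rightarrow> (nat \<Rightarrow> 'a \<Rightarrow> real) \<Rightarrow> real \<Rightarrow> nat \<Rightarrow> 'a set" where
  "early_completed I Q \<alpha> t = (\<Union>n\<in>{n. \<alpha> * real n \<le> real t}. completed I Q n)"

definition lagging ::
  "'a sched_instance \<Rightarrow> (nat \<Rightarrow> 'a \<Rightarrow> real) \<Rightarrow> (nat \<Rightarrow> 'a \<Rightarrow> real) \<Rightarrow> real \<Rightarrow> nat \<Rightarrow> 'a set" where
  "lagging I R Q \<alpha> t = (front I R t - saturated I R t) \<inter> early_completed I Q \<alpha> t"

definition weight_proportional ::
  "nat \<Rightarrow> real \<Rightarrow> 'a sched_instance \<Rightarrow> (nat \<Rightarrow> 'a \<Rightarrow> real) \<Rightarrow> bool" where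
  "weight_proportional m \<rho> I R \<longleftrightarrow>
     (\<forall>t\<ge>1. \<forall>j\<in>front I R t. R t j < 1 \<longrightarrow>
        real m * (total_weight I (successors I j) / front_weight I R t) \<le> \<rho> * R t j)"

lemma early_completed_subset_jobs: "early_completed I Q \<alpha> t \<subseteq> jobs I"
  by (auto simp: early_completed_def dest: completed_imp_job)

lemma early_completed_mono: "s \<le> t \<Longrightarrow> early_completed I Q \<alpha> s \<subseteq> early_completed I Q \<alpha> t"
  unfolding early_completed_def by (intro UN_mono) (auto intro: order_trans[OF _ of_nat_mono])

lemma card_slots_not_early_completed_le:
  assumes "0 \<le> \<alpha>" "v \<in> completed I Q c"
  shows "real (card {t \<in> {1..T}. v \<in> (\<Union>i\<in>X t - early_completed I Q \<alpha> t. successors I i)})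
    \<le> \<alpha> * real c"
proof -
  have "real t < \<alpha> * real c" if "v \<in> (\<Union>i\<in>X t - early_completed I Q \<alpha> t. successors I i)" for t
  proof -
    from that obtain i where i: "i \<notin> early_completed I Q \<alpha> t" "v \<in> successors I i" by blast
    from assms(2) i(2) have "i \<in> completed I Q c" by (rule completed_successorsD)
    with i(1) show ?thesis by (auto simp: early_completed_def not_le)
  qed
  then have "card {t \<in> {1..T}. v \<in> (\<Union>i\<in>X t - early_completed I Q \<alpha> t. successors I i)}
      \<le> card {t \<in> {1..T}. real t < \<alpha> * real c}"
    by (intro card_mono) auto
  also have "real \<dots> \<le> \<alpha> * real c"
    using assms(1) by (intro card_nat_less_real_le) simp
  finally show ?thesis by simp
qed

lemma sum_proc_early_completed_le:
  assumes "feasible m I Q" "finite (jobs I)" "0 \<le> \<alpha>"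
  shows "\<alpha> * (\<Sum>i\<in>early_completed I Q \<alpha> t. proc I i) \<le> real m * real t"
proof (cases "\<alpha> = 0")
  case False
  define n where "n = nat \<lfloor>real t / \<alpha>\<rfloor>"
  have "0 < \<alpha>" using assms(3) False by simp
  have "k \<le> n" if "\<alpha> * real k \<le> real t" for k
    using that \<open>0 < \<alpha>\<close> unfolding n_def by (intro le_nat_floor) (simp add: field_simps)
  then have "early_completed I Q \<alpha> t \<subseteq> completed I Q n"
    unfolding early_completed_def by (intro UN_least completed_mono) simp
  then have "(\<Sum>i\<in>early_completed I Q \<alpha> t. proc I i) \<le> real m * real n"
    using assms(1,2) by (intro sum_proc_completed_le)
  also have "\<dots> \<le> real m * (real t / \<alpha>)"
    unfolding n_def using \<open>0 < \<alpha>\<close> by (intro mult_left_mono of_nat_floor) auto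
  finally show ?thesis using \<open>0 < \<alpha>\<close> by (simp add: field_simps)
qed simp

context dag_instance
begin

lemma finite_early_completed: "finite (early_completed I Q \<alpha> t)"
  using early_completed_subset_jobs finite_jobs by (rule finite_subset)

lemma sum_rates_lagging_le:
  assumes "feasible m' I R" "feasible m I Q" "0 \<le> \<alpha>"
  shows "\<alpha> * (\<Sum>u = 1..t. \<Sum>i\<in>lagging I R Q \<alpha> u. R u i) \<le> real m * real t"
proof -
  let ?E = "early_completed I Q \<alpha> t"
  have "(\<Sum>u = 1..t. \<Sum>i\<in>lagging I R Q \<alpha> u. R u i) \<le>
      (\<Sum>u = 1..t. \<Sum>i\<in>{i \<in> ?E. i \<in> front I R u - saturated I R u}. R u i)"
    using assms(1) finite_early_completed
    by (intro sum_mono sum_mono2)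
      (auto simp: lagging_def feasible_def front_def dest: subsetD[OF early_completed_mono])
  also have "\<dots> = (\<Sum>i\<in>?E. \<Sum>u\<in>{u \<in> {1..t}. i \<in> front I R u - saturated I R u}. R u i)"
    by (rule sum.swap_restrict) (use finite_early_completed in auto)
  also have "\<dots> \<le> (\<Sum>i\<in>?E. proc I i)"
  proof (rule sum_mono)
    fix i assume "i \<in> ?E"
    let ?K = "{u \<in> {1..t}. i \<in> front I R u - saturated I R u}"
    show "(\<Sum>u\<in>?K. R u i) \<le> proc I i"
    proof (cases "?K = {}")
      case True
      have "i \<in> jobs I" using \<open>i \<in> ?E\<close> early_completed_subset_jobs by (rule subsetD[rotated])
      then show ?thesis unfolding True using proc_nonneg by simp
    next
      case False
      then have "(\<Sum>u\<in>?K. R u i) < proc I i"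
        using assms(1) front_diff_saturatedD(2)[OF assms(1)] by (intro sum_rates_less_proc) auto
      then show ?thesis by simp
    qed
  qed
  finally have "\<alpha> * (\<Sum>u = 1..t. \<Sum>i\<in>lagging I R Q \<alpha> u. R u i) \<le> \<alpha> * (\<Sum>i\<in>?E. proc I i)"
    using assms(3) by (rule mult_left_mono)
  also have "\<dots> \<le> real m * real t"
    using assms(2) finite_jobs assms(3) by (rule sum_proc_early_completed_le)
  finally show ?thesis .
qed

lemma weight_proportionalD:
  assumes "weight_proportional m \<rho> I R" "1 \<le> t" "i \<in> front I R t" "R t i < 1"
  shows "real m * total_weight I (successors I i) \<le> front_weight I R t * (\<rho> * R t i)"
proof (cases "front_weight I R t = 0")
  case True \<comment> \<open>the hypothesis is void here, because \<open>x / 0 = 0\<close>\<close>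
  have "total_weight I (successors I i) \<le> front_weight I R t"
    unfolding front_weight_def using assms(3)
    by (intro total_weight_mono UN_successors_subset_jobs front_subset_jobs) blast
  with True show ?thesis by (simp add: mult_nonneg_nonpos)
next
  case False
  then have "0 < front_weight I R t" using front_weight_nonneg[of R t] by simp
  with assms show ?thesis by (auto simp: weight_proportional_def field_simps)
qed

lemma lagging_weight_le:
  assumes "feasible m' I R" "weight_proportional m \<rho> I R" "1 \<le> t"
  shows "real m * total_weight I (\<Union>i\<in>lagging I R Q \<alpha> t. successors I i)
    \<le> front_weight I R t * (\<rho> * (\<Sum>i\<in>lagging I R Q \<alpha> t. R t i))"
proof -
  let ?L = "lagging I R Q \<alpha> t"
  have lagging: "i \<in> front I R t" "R t i < 1" if "i \<in> ?L" for i
    using that front_diff_saturatedD(1)[OF assms(1,3)] by (auto simp: lagging_def)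
  have "finite ?L" by (simp add: lagging_def finite_early_completed)
  then have "total_weight I (\<Union>i\<in>?L. successors I i) \<le> (\<Sum>i\<in>?L. total_weight I (successors I i))"
    using lagging(1) by (intro total_weight_UN_le successors_subset_jobs) (auto simp: front_def)
  then have "real m * total_weight I (\<Union>i\<in>?L. successors I i)
      \<le> real m * (\<Sum>i\<in>?L. total_weight I (successors I i))"
    by (rule mult_left_mono) simp
  also have "\<dots> = (\<Sum>i\<in>?L. real m * total_weight I (successors I i))"
    by (rule sum_distrib_left)
  also have "\<dots> \<le> (\<Sum>i\<in>?L. front_weight I R t * (\<rho> * R t i))"
    using assms(2,3) lagging by (intro sum_mono weight_proportionalD)
  finally show ?thesis by (simp add: sum_distrib_left)
qed

lemma sum_lagging_weight_le:
  assumes R: "feasible m' I R" "weight_proportional m \<rho> I R" and Q: "feasible m I Q"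
    and "1 \<le> m" "0 \<le> \<rho>" "0 \<le> \<kappa>"
  shows "\<kappa> * (\<Sum>t = 1..T. total_weight I (\<Union>i\<in>lagging I R Q (\<kappa> * \<rho>) t. successors I i))
    \<le> (\<Sum>t = 1..T. front_weight I R t)"
proof -
  let ?L = "lagging I R Q (\<kappa> * \<rho>)"
  define h where "h t = \<kappa> * \<rho> * (\<Sum>i\<in>?L t. R t i)" for t
  have "real m * (\<kappa> * (\<Sum>t = 1..T. total_weight I (\<Union>i\<in>?L t. successors I i)))
      = (\<Sum>t = 1..T. \<kappa> * (real m * total_weight I (\<Union>i\<in>?L t. successors I i)))"
    by (simp add: sum_distrib_left mult.left_commute)
  also have "\<dots> \<le> (\<Sum>t = 1..T. \<kappa> * (front_weight I R t * (\<rho> * (\<Sum>i\<in>?L t. R t i))))"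
    using \<open>0 \<le> \<kappa>\<close> by (intro sum_mono mult_left_mono lagging_weight_le[OF R]) auto
  also have "\<dots> = (\<Sum>t = 1..T. front_weight I R t * h t)"
    by (simp add: h_def mult_ac)
  also have "\<dots> \<le> real m * (\<Sum>t = 1..T. front_weight I R t)"
  proof (rule sum_mult_antimono_le)
    show "(\<Sum>u = 1..t. h u) \<le> real m * real t" for t
      using sum_rates_lagging_le[OF R(1) Q, of "\<kappa> * \<rho>" t] \<open>0 \<le> \<kappa>\<close> \<open>0 \<le> \<rho>\<close>
      by (simp add: h_def sum_distrib_left)
  qed (rule front_weight_Suc_le front_weight_nonneg)+
  finally show ?thesis using \<open>1 \<le> m\<close> by simp
qed

end

section \<open>Competitiveness\<close>

context out_forest
begin

lemma card_slots_nonlagging_ancestor_le: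
  assumes "feasible m I R" "feasible m' I Q" "0 \<le> \<alpha>" "v \<in> completed I Q c"
  shows "real (card {t \<in> {1..T}. v \<in> (\<Union>i\<in>front I R t - lagging I R Q \<alpha> t. successors I i)})
    \<le> (1 + \<alpha>) * real c"
proof -
  let ?S = "{t \<in> {1..T}. v \<in> (\<Union>i\<in>saturated I R t. successors I i)}"
  let ?F = "{t \<in> {1..T}. v \<in> (\<Union>i\<in>front I R t - early_completed I Q \<alpha> t. successors I i)}"
  have "{t \<in> {1..T}. v \<in> (\<Union>i\<in>front I R t - lagging I R Q \<alpha> t. successors I i)} = ?S \<union> ?F"
    by (auto simp: lagging_def saturated_def)
  also have "card \<dots> \<le> card ?S + card ?F" by (rule card_Un_le)
  also have "card ?S \<le> c"
    using assms(1,2,4) by (rule card_slots_saturated_ancestor_le)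
  finally have "real (card {t \<in> {1..T}. v \<in> (\<Union>i\<in>front I R t - lagging I R Q \<alpha> t. successors I i)})
      \<le> real c + real (card ?F)" by simp
  also have "real (card ?F) \<le> \<alpha> * real c"
    using assms(3,4) by (rule card_slots_not_early_completed_le)
  finally show ?thesis by (simp add: distrib_right)
qed

lemma total_cost_le_feasible:
  assumes R: "feasible m' I R" "weight_proportional m \<rho> I R" and Q: "feasible m I Q"
    and "1 \<le> m" "0 \<le> \<rho>"
  shows "total_cost I R \<le> ennreal (2 + 4 * \<rho>) * total_cost I Q"
proof (rule total_cost_leI)
  fix T
  let ?L = "lagging I R Q (2 * \<rho>)"
  let ?charged = "\<Sum>t = 1..T. total_weight I (\<Union>i\<in>front I R t - ?L t. successors I i)"
  let ?lagging = "\<Sum>t = 1..T. total_weight I (\<Union>i\<in>?L t. successors I i)"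
  have "(\<Sum>t = 1..T. front_weight I R t) \<le> ?charged + ?lagging"
    unfolding sum.distrib[symmetric]
    by (intro sum_mono front_weight_le_diff) (auto simp: lagging_def)
  moreover have "2 * ?lagging \<le> (\<Sum>t = 1..T. front_weight I R t)"
    using R Q assms(4,5) by (rule sum_lagging_weight_le) simp
  ultimately have "ennreal (\<Sum>t = 1..T. front_weight I R t) \<le> ennreal (2 * ?charged)"
    by (intro ennreal_leI) simp
  also have "\<dots> = 2 * ennreal ?charged"
    by (simp add: ennreal_mult')
  also have "\<dots> \<le> 2 * (ennreal (1 + 2 * \<rho>) * total_cost I Q)"
  proof (intro mult_left_mono sum_total_weight_le_total_cost)
    show "(\<Union>i\<in>front I R t - ?L t. successors I i) \<subseteq> jobs I" for t
      by (rule UN_successors_subset_jobs) (auto simp: front_def)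
    show "real (card {t \<in> {1..T}. v \<in> (\<Union>i\<in>front I R t - ?L t. successors I i)})
        \<le> (1 + 2 * \<rho>) * real c" if "v \<in> completed I Q c" for v c
      using R(1) Q _ that by (rule card_slots_nonlagging_ancestor_le) (use \<open>0 \<le> \<rho>\<close> in simp)
  qed (use \<open>0 \<le> \<rho>\<close> in auto)
  also have "\<dots> = ennreal (2 * (1 + 2 * \<rho>)) * total_cost I Q"
    using \<open>0 \<le> \<rho>\<close> by (simp only: ennreal_mult' ennreal_numeral mult.assoc)
  finally show "ennreal (\<Sum>t = 1..T. front_weight I R t) \<le> ennreal (2 + 4 * \<rho>) * total_cost I Q"
    by (simp add: algebra_simps)
qed

lemma total_cost_le_opt:
  assumes "feasible m' I R" "weight_proportional m \<rho> I R" "1 \<le> m" "0 \<le> \<rho>"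
  shows "total_cost I R \<le> ennreal (2 + 4 * \<rho>) * opt m I"
  unfolding opt_def
proof (rule ennreal_le_mult_INF)
  fix Q assume "Q \<in> {Q. feasible m I Q}"
  with assms show "total_cost I R \<le> ennreal (2 + 4 * \<rho>) * total_cost I Q"
    by (intro total_cost_le_feasible) auto
qed (use assms(4) in \<open>auto simp del: ennreal_plus\<close>)

end

lemma out_forest_if_out_forest_instance: "out_forest_instance I \<Longrightarrow> out_forest I"
  by unfold_locales (auto simp: out_forest_instance_def, blast)

theorem theorem11:
  fixes A :: "'a sched_instance \<Rightarrow> nat \<Rightarrow> 'a \<Rightarrow> real"
    and pred :: "'a sched_instance \<Rightarrow> 'p"
    and m :: nat and \<rho> :: real
  assumes "1 \<le> m" and "0 \<le> \<rho>"
    and "online_algorithm m pred A"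
    and "\<And>I t j. out_forest_instance I \<Longrightarrow> 1 \<le> t \<Longrightarrow> j \<in> front I (A I) t \<Longrightarrow> A I t j < 1 \<Longrightarrow>
           real m * (total_weight I (successors I j) / front_weight I (A I) t) \<le> \<rho> * A I t j"
  shows "competitive m A (2 + 4 * \<rho>)"
  unfolding competitive_def
proof (intro allI impI)
  fix I :: "'a sched_instance" assume I: "out_forest_instance I"
  then interpret out_forest I by (rule out_forest_if_out_forest_instance)
  have "feasible m I (A I)" using assms(3) I by (simp add: online_algorithm_def)
  moreover have "weight_proportional m \<rho> I (A I)"
    using assms(4)[OF I] by (simp add: weight_proportional_def)
  ultimately show "total_cost I (A I) \<le> ennreal (2 + 4 * \<rho>) * opt m I"
    using assms(1,2) by (rule total_cost_le_opt)
qed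

end
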